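(* For an integer $n \geq 1$ let $X_n = \{1, 2, \ldots, n\}$ and $maxSum(n) = \frac{n(n+1)}{2}$. For integers $S$ and $e$, let $SD[n][S]$ denote the number of subsets $A \subseteq X_n$ with $\sum_{a \in A} a = S$, and let $ED[n][S][e]$ denote the number of subsets $A \subseteq X_n$ with $\sum_{a \in A} a = S$ and $e \in A$. If $S$ is an integer with $\frac{n(n-1)}{2} + 1 \leq S \leq \frac{n(n+1)}{2}$ and $e$ is an integer with $1 \leq e < n$, then $$ED[n][S][e] = SD[n][S] - ED[n][maxSum(n) - S][e].$$
   Context: Subsets include the empty set, whose sum is taken to be $0$. *)

theory Defs
  imports Main
begin

definition X :: "int \<Rightarrow> int set" where
  "X n = {1..n}"

(* n * (n + 1) is even, so the integer division is exact. *)
definition maxSum :: "int \<Rightarrow> int" where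
  "maxSum n = n * (n + 1) div 2"

definition SD :: "int \<Rightarrow> int \<Rightarrow> nat" where
  "SD n S = card {A. A \<subseteq> X n \<and> (\<Sum>a\<in>A. a) = S}"

definition ED :: "int \<Rightarrow> int \<Rightarrow> int \<Rightarrow> nat" where
  "ED n S e = card {A. A \<subseteq> X n \<and> (\<Sum>a\<in>A. a) = S \<and> e \<in> A}"

end

theory Submission
  imports Defs
begin

text \<open>Complementation in \<open>X n\<close> turns a subset with sum \<open>S\<close> that
  omits \<open>e\<close> into one with sum \<open>maxSum n - S\<close> that contains
  \<open>e\<close>, and conversely. So the subtracted term counts the subsets of sum
  \<open>S\<close> that avoid \<open>e\<close> (\<open>ED_maxSum_minus\<close>); splitting all
  subsets of sum \<open>S\<close> by membership of \<open>e\<close> (\<open>SD_split\<close>) gives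
  the identity.\<close>

lemma finite_X [simp]: "finite (X n)"
  by (simp add: X_def)

lemma sum_X:
  assumes "n \<ge> 0"
  shows "\<Sum>(X n) = maxSum n"
proof -
  \<comment> \<open>Doubling keeps \<open>div\<close> out of the induction.\<close>
  have "2 * \<Sum>{1..n} = n * (n + 1)"
    using assms
  proof (induction n rule: int_ge_induct)
    case (step i)
    then have "{1..i + 1} = insert (i + 1) {1..i}" by auto
    with step show ?case by (simp add: algebra_simps)
  qed simp
  then show ?thesis by (simp add: X_def maxSum_def)
qed

lemma sum_X_Diff:
  assumes "n \<ge> 0" "A \<subseteq> X n"
  shows "\<Sum>(X n - A) = maxSum n - \<Sum>A"
  using assms by (simp add: sum_diff sum_X)

lemma ED_maxSum_minus:
  assumes "n \<ge> 0" "e \<in> X n"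
  shows "ED n (maxSum n - S) e = card {A. A \<subseteq> X n \<and> \<Sum>A = S \<and> e \<notin> A}"
  unfolding ED_def
  \<comment> \<open>Complementation is an involution on subsets of \<open>X n\<close>, so the same
    map serves as its own inverse.\<close>
  by (rule bij_betw_same_card[of "\<lambda>A. X n - A"],
      rule bij_betw_byWitness[where f' = "\<lambda>A. X n - A"])
    (use assms in \<open>auto simp: sum_X_Diff double_diff\<close>)

lemma SD_split:
  "SD n S = ED n S e + card {A. A \<subseteq> X n \<and> \<Sum>A = S \<and> e \<notin> A}"
  unfolding SD_def ED_def
  \<comment> \<open>Both families consist of subsets of the finite set \<open>X n\<close>, hence are
    finite; \<open>e\<close> separates them.\<close>
  by (subst card_Un_disjoint[symmetric]) (auto intro: arg_cong[where f = card])

theorem theorem4: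
  fixes n S e :: int
  assumes "n \<ge> 1"
    and "n * (n - 1) div 2 + 1 \<le> S" and "S \<le> n * (n + 1) div 2"
    and "1 \<le> e" and "e < n"
  shows "int (ED n S e) = int (SD n S) - int (ED n (maxSum n - S) e)"
proof -
  have "e \<in> X n" using assms by (simp add: X_def)
  with assms show ?thesis
    by (simp add: ED_maxSum_minus SD_split[of n S e])
qed

end
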